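(* The interval $[\mathsf{V}(S_7),\mathsf{V}(B_2^1)]$ in the lattice of varieties of additively idempotent semirings has cardinality $2^{\aleph_0}$.
   Context: An additively idempotent semiring (ai-semiring) is an algebra $(S,+,\cdot)$ such that $(S,+)$ is a commutative idempotent semigroup, $(S,\cdot)$ is a semigroup, and $x(y+z)\approx xy+xz$, $(x+y)z\approx xz+yz$ hold. No constants are part of the signature. It is ordered by $a\le b \Leftrightarrow a+b=b$, so that $a+b$ is the supremum of $a,b$. For an ai-semiring $A$, $\mathsf{V}(A)$ denotes the variety of ai-semirings generated by $A$. For varieties $\mathcal{W}\subseteq\mathcal{V}$, the interval $[\mathcal{W},\mathcal{V}]$ is the collection of all varieties $\mathcal{U}$ with $\mathcal{W}\subseteq\mathcal{U}\subseteq\mathcal{V}$. $S_7$ is the ai-semiring on $\{0,a,1\}$ in which $x+x=x$ and $x+y=0$ for all distinct $x,y$, and in which $0$ is a multiplicative zero, $1$ is a multiplicative identity, and $a\cdot a=0$. $B_2^1$ is the ai-semiring whose elements are the six $2\times 2$ matrices $0=\begin{pmatrix}0&0\\0&0\end{pmatrix}$, $1=\begin{pmatrix}1&0\\0&1\end{pmatrix}$, $a=\begin{pmatrix}0&1\\0&0\end{pmatrix}$, $b=\begin{pmatrix}0&0\\1&0\end{pmatrix}$, $ab=\begin{pmatrix}1&0\\0&0\end{pmatrix}$, $ba=\begin{pmatrix}0&0\\0&1\end{pmatrix}$, with ordinary matrix multiplication as $\cdot$, and whose addition is the supremum operation of the partial order $\le$ with covering relations $1<ab$, $1<ba$, $ab<0$,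 $ba<0$, $a<0$, $b<0$ (so $1+ab=ab$, $1+ba=ba$, and every other sum of two distinct elements is $0$). The subset $\{0,a,1\}$ of $B_2^1$ is a copy of $S_7$, so $\mathsf{V}(S_7)\subseteq\mathsf{V}(B_2^1)$. *)

theory Defs
  imports "HOL-Analysis.Analysis" "HOL-Library.Equipollence" "HOL-Library.Infinite_Typeclass"
begin

record 'a semiring_alg =
  carr :: "'a set"
  add :: "'a \<Rightarrow> 'a \<Rightarrow> 'a"
  mul :: "'a \<Rightarrow> 'a \<Rightarrow> 'a"

locale ai_semiring =
  fixes A :: "'a semiring_alg"
  assumes carr_nonempty: "carr A \<noteq> {}"
    and add_closed: "\<lbrakk>x \<in> carr A; y \<in> carr A\<rbrakk> \<Longrightarrow> add A x y \<in> carr A"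
    and mul_closed: "\<lbrakk>x \<in> carr A; y \<in> carr A\<rbrakk> \<Longrightarrow> mul A x y \<in> carr A"
    and add_assoc: "\<lbrakk>x \<in> carr A; y \<in> carr A; z \<in> carr A\<rbrakk>
          \<Longrightarrow> add A (add A x y) z = add A x (add A y z)"
    and add_comm: "\<lbrakk>x \<in> carr A; y \<in> carr A\<rbrakk> \<Longrightarrow> add A x y = add A y x"
    and add_idem: "x \<in> carr A \<Longrightarrow> add A x x = x"
    and mul_assoc: "\<lbrakk>x \<in> carr A; y \<in> carr A; z \<in> carr A\<rbrakk>
          \<Longrightarrow> mul A (mul A x y) z = mul A x (mul A y z)"
    and distrib_left: "\<lbrakk>x \<in> carr A; y \<in> carr A; z \<in> carr A\<rbrakk>
          \<Longrightarrow> mul A x (add A y z) = add A (mul A x y) (mul A x z)"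
    and distrib_right: "\<lbrakk>x \<in> carr A; y \<in> carr A; z \<in> carr A\<rbrakk>
          \<Longrightarrow> mul A (add A x y) z = add A (mul A x z) (mul A y z)"

datatype trm = Var nat | Plus trm trm | Times trm trm

primrec evaluate :: "'a semiring_alg \<Rightarrow> (nat \<Rightarrow> 'a) \<Rightarrow> trm \<Rightarrow> 'a" where
  "evaluate A v (Var n) = v n"
| "evaluate A v (Plus s t) = add A (evaluate A v s) (evaluate A v t)"
| "evaluate A v (Times s t) = mul A (evaluate A v s) (evaluate A v t)"

text \<open>An identity is a pair of terms.\<close>

definition satisfies :: "'a semiring_alg \<Rightarrow> trm \<times> trm \<Rightarrow> bool" where
  "satisfies A e \<longleftrightarrow>
     (\<forall>v. range v \<subseteq> carr A \<longrightarrow> evaluate A v (fst e) = evaluate A v (snd e))"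

definition identities :: "'a semiring_alg \<Rightarrow> (trm \<times> trm) set" where
  "identities A = {e. satisfies A e}"

definition models :: "(trm \<times> trm) set \<Rightarrow> 'u semiring_alg set" where
  "models E = {A. ai_semiring A \<and> (\<forall>e\<in>E. satisfies A e)}"

text \<open>
  A variety is an equational class. HOL has no quantification over all algebras of all types,
  so a class consists of the ai-semirings whose carrier is a subset of a type \<open>'u\<close>. If \<open>'u\<close> is
  infinite, nothing is lost: identities involve finitely many variables, so a variety is
  determined by its countable members, and inclusion between varieties can be tested on these.
\<close>

definition variety :: "'u semiring_alg set \<Rightarrow> bool" where
  "variety K \<longleftrightarrow> (\<exists>E. K = models E)"

text \<open>
  The generating algebra may live on a type other than \<open>'u\<close>; the lemma below treats the case
  where it does not.
\<close>

definition variety_generated_by :: "'a semiring_alg \<Rightarrow> 'u semiring_alg set" where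
  "variety_generated_by A = models (identities A)"

lemma variety_generated_by_least:
  fixes A :: "'u semiring_alg"
  assumes "ai_semiring A"
  shows "variety_generated_by A = \<Inter>{K. variety K \<and> A \<in> K}"
proof
  show "variety_generated_by A \<subseteq> \<Inter>{K. variety K \<and> A \<in> K}"
    by (auto simp: variety_generated_by_def variety_def models_def identities_def)
  have "variety (variety_generated_by A)"
    unfolding variety_generated_by_def variety_def by (rule exI, rule refl)
  moreover have "A \<in> variety_generated_by A"
    using assms by (simp add: variety_generated_by_def models_def identities_def)
  ultimately show "\<Inter>{K. variety K \<and> A \<in> K} \<subseteq> variety_generated_by A"
    by blast
qed

definition variety_interval ::
    "'u semiring_alg set \<Rightarrow> 'u semiring_alg set \<Rightarrow> 'u semiring_alg set set" where
  "variety_interval W V = {U. variety U \<and> W \<subseteq> U \<and> U \<subseteq> V}"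

datatype s7 = S0 | Sa | S1

definition S7 :: "s7 semiring_alg" where
  "S7 = \<lparr>carr = UNIV,
         add = (\<lambda>x y. if x = y then x else S0),
         mul = (\<lambda>x y. if x = S1 then y else if y = S1 then x else S0)\<rparr>"

definition mA :: "int^2^2" where "mA = vector [vector [0, 1], vector [0, 0]]"
definition mB :: "int^2^2" where "mB = vector [vector [0, 0], vector [1, 0]]"
definition mAB :: "int^2^2" where "mAB = vector [vector [1, 0], vector [0, 0]]"
definition mBA :: "int^2^2" where "mBA = vector [vector [0, 0], vector [0, 1]]"

definition B21_carrier :: "(int^2^2) set" where
  "B21_carrier = {0, mat 1, mA, mB, mAB, mBA}"

inductive B21_covers :: "int^2^2 \<Rightarrow> int^2^2 \<Rightarrow> bool" where
  "B21_covers (mat 1) mAB"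
| "B21_covers (mat 1) mBA"
| "B21_covers mAB 0"
| "B21_covers mBA 0"
| "B21_covers mA 0"
| "B21_covers mB 0"

definition B21_le :: "int^2^2 \<Rightarrow> int^2^2 \<Rightarrow> bool" where
  "B21_le = B21_covers\<^sup>*\<^sup>*"

text \<open>The supremum for \<open>B21_le\<close> on the carrier, see \<open>B21_plus_is_sup\<close>.\<close>

definition B21_plus :: "int^2^2 \<Rightarrow> int^2^2 \<Rightarrow> int^2^2" where
  "B21_plus x y =
     (if x = y then x
      else if {x, y} = {mat 1, mAB} then mAB
      else if {x, y} = {mat 1, mBA} then mBA
      else 0)"

definition B21 :: "(int^2^2) semiring_alg" where
  "B21 = \<lparr>carr = B21_carrier, add = B21_plus, mul = (**)\<rparr>"

lemma mat_defs: "(0::int^2^2) = vector [vector [0, 0], vector [0, 0]]"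
  "(mat 1::int^2^2) = vector [vector [1, 0], vector [0, 1]]"
  by (simp_all add: vec_eq_iff forall_2 mat_def)

lemma B21_distinct: "distinct [0, mat 1, mA, mB, mAB, mBA]"
  by (simp add: mat_defs mA_def mB_def mAB_def mBA_def vec_eq_iff forall_2)

lemma B21_mult:
  "mA ** mB = mAB" "mB ** mA = mBA" "mA ** mA = 0" "mB ** mB = 0"
  "mA ** mAB = 0" "mA ** mBA = mA" "mB ** mAB = mB" "mB ** mBA = 0"
  "mAB ** mA = mA" "mAB ** mB = 0" "mBA ** mA = 0" "mBA ** mB = mB"
  "mAB ** mAB = mAB" "mAB ** mBA = 0" "mBA ** mAB = 0" "mBA ** mBA = mBA"
  by (simp_all add: mA_def mB_def mAB_def mBA_def vec_eq_iff forall_2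
      matrix_matrix_mult_def sum_2)

lemma B21_le_iff:
  "B21_le x y \<longleftrightarrow> x = y \<or> B21_covers x y \<or> x = mat 1 \<and> y = 0"
proof
  assume "B21_le x y"
  then have "B21_covers\<^sup>*\<^sup>* x y" by (simp add: B21_le_def)
  then show "x = y \<or> B21_covers x y \<or> x = mat 1 \<and> y = 0"
    by induction (use B21_distinct in \<open>auto simp: B21_covers.simps\<close>)
next
  assume "x = y \<or> B21_covers x y \<or> x = mat 1 \<and> y = 0"
  then show "B21_le x y"
    unfolding B21_le_def by (meson B21_covers.intros(1,3) converse_rtranclp_into_rtranclp
        r_into_rtranclp rtranclp.rtrancl_refl)
qed

lemma B21_plus_table:
  "B21_plus x x = x" "B21_plus (mat 1) mAB = mAB" "B21_plus mAB (mat 1) = mAB"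
  "B21_plus (mat 1) mBA = mBA" "B21_plus mBA (mat 1) = mBA"
  "B21_plus 0 x = 0" "B21_plus x 0 = 0"
  "B21_plus (mat 1) mA = 0" "B21_plus mA (mat 1) = 0"
  "B21_plus (mat 1) mB = 0" "B21_plus mB (mat 1) = 0"
  "B21_plus mA mB = 0" "B21_plus mB mA = 0"
  "B21_plus mA mAB = 0" "B21_plus mAB mA = 0" "B21_plus mA mBA = 0" "B21_plus mBA mA = 0"
  "B21_plus mB mAB = 0" "B21_plus mAB mB = 0" "B21_plus mB mBA = 0" "B21_plus mBA mB = 0"
  "B21_plus mAB mBA = 0" "B21_plus mBA mAB = 0"
  using B21_distinct by (simp_all add: B21_plus_def doubleton_eq_iff) auto

lemma B21_plus_is_sup:
  assumes "x \<in> B21_carrier" "y \<in> B21_carrier"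
  shows "B21_plus x y \<in> B21_carrier" "B21_le x (B21_plus x y)" "B21_le y (B21_plus x y)"
    and "\<lbrakk>z \<in> B21_carrier; B21_le x z; B21_le y z\<rbrakk> \<Longrightarrow> B21_le (B21_plus x y) z"
proof -
  note cases = assms[unfolded B21_carrier_def, simplified]
  note neqs = B21_distinct[simplified]
  note le = B21_le_iff B21_covers.simps
  show "B21_plus x y \<in> B21_carrier"
    by (simp add: B21_plus_def B21_carrier_def cases)
  show "B21_le x (B21_plus x y)"
    using cases by (elim disjE; simp add: B21_plus_table le)
  show "B21_le y (B21_plus x y)"
    using cases by (elim disjE; simp add: B21_plus_table le)
  assume z: "B21_le x z" "B21_le y z"
  show "B21_le (B21_plus x y) z"
    using cases z neqs by (elim disjE; simp add: B21_plus_table le; auto)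
qed

lemma ai_semiring_S7: "ai_semiring S7"
proof
  fix x y z :: s7
  show "mul S7 (mul S7 x y) z = mul S7 x (mul S7 y z)"
    by (cases x; cases y; cases z) (simp_all add: S7_def)
  show "mul S7 x (add S7 y z) = add S7 (mul S7 x y) (mul S7 x z)"
    by (cases x; cases y; cases z) (simp_all add: S7_def)
  show "mul S7 (add S7 x y) z = add S7 (mul S7 x z) (mul S7 y z)"
    by (cases x; cases y; cases z) (simp_all add: S7_def)
qed (auto simp: S7_def)

lemma ai_semiring_B21: "ai_semiring B21"
proof
  have Z: "(0::int^2^2) ** x = 0" "x ** (0::int^2^2) = 0" for x
    by (simp_all add: vec_eq_iff matrix_matrix_mult_def)
  note table = B21_plus_table B21_mult Z
  have E: "x = 0 \<or> x = mat 1 \<or> x = mA \<or> x = mB \<or> x = mAB \<or> x = mBA" if "x \<in> carr B21" for x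
    using that by (simp add: B21_def B21_carrier_def)
  show "carr B21 \<noteq> {}"
    by (simp add: B21_def B21_carrier_def)
  fix x y z
  assume x: "x \<in> carr B21"
  show "add B21 x x = x"
    by (simp add: B21_def B21_plus_def)
  assume y: "y \<in> carr B21"
  show "add B21 x y \<in> carr B21"
    using E[OF x] E[OF y] by (simp add: B21_def B21_plus_def B21_carrier_def)
  show "add B21 x y = add B21 y x"
    by (simp add: B21_def B21_plus_def insert_commute)
  show "mul B21 x y \<in> carr B21"
    using E[OF x] E[OF y] by (elim disjE; simp add: B21_def B21_carrier_def table)
  assume z: "z \<in> carr B21"
  show "add B21 (add B21 x y) z = add B21 x (add B21 y z)"
    using E[OF x] E[OF y] E[OF z]
    by (elim disjE; hypsubst; simp only: B21_def semiring_alg.simps table)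
  show "mul B21 (mul B21 x y) z = mul B21 x (mul B21 y z)"
    by (simp add: B21_def matrix_mul_assoc)
  show "mul B21 x (add B21 y z) = add B21 (mul B21 x y) (mul B21 x z)"
    using E[OF x] E[OF y] E[OF z]
    by (elim disjE; hypsubst; simp only: B21_def semiring_alg.simps table matrix_mul_lid matrix_mul_rid)
  show "mul B21 (add B21 x y) z = add B21 (mul B21 x z) (mul B21 y z)"
    using E[OF x] E[OF y] E[OF z]
    by (elim disjE; hypsubst; simp only: B21_def semiring_alg.simps table matrix_mul_lid matrix_mul_rid)
qed

end

theory Submission imports Defs begin

text \<open>
  Given an irreflexive relation \<open>ok\<close> on letters, let the nonempty sets of letters together with a
  zero form a flat semiring in which \<open>P \<cdot> Q = P \<union> Q\<close> if \<open>ok p q\<close> for all \<open>p \<in> P\<close>, \<open>q \<in> Q\<close>, and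
  \<open>P \<cdot> Q = 0\<close> otherwise. It lies in the variety of \<open>B\<^sub>2\<^sup>1\<close>: to recover the value \<open>Q\<close> of a term, use
  for every \<open>x \<in> Q\<close> the assignment to \<open>B\<^sub>2\<^sup>1\<close> that sends a variable to \<open>a\<close> if its value contains
  \<open>x\<close>, and otherwise to \<open>ab\<close>, \<open>ba\<close> or \<open>1\<close> according to the side of \<open>x\<close> to which it is confined.

  Now let \<open>ok i j\<close> hold whenever \<open>i < j\<close>, and \<open>ok j i\<close> only along the edges of a graph, so that
  the edges are the commuting pairs. Taking as graph a path with a fork at both ends, let an
  identity say that the sum of linear words witnessing all these commutations does not change when
  one of them is reversed. It holds in the commutative \<open>S\<^sub>7\<close>. If it fails in the
  algebra of another such graph, then choosing a letter from the value of each variable embeds the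
  first graph into the second. Since double forks of different sizes do not embed into each
  other, these identities are independent.
\<close>

section \<open>Identities and varieties\<close>

lemma evaluate_closed:
  assumes "ai_semiring A" "range v \<subseteq> carr A"
  shows "evaluate A v t \<in> carr A"
  using assms by (induction t) (auto simp: ai_semiring.add_closed ai_semiring.mul_closed)

lemma identities_antimono_embedding:
  assumes A: "ai_semiring A" and g: "inj_on g (carr A)" "g ` carr A \<subseteq> carr B"
    and add: "\<And>x y. \<lbrakk>x \<in> carr A; y \<in> carr A\<rbrakk> \<Longrightarrow> g (add A x y) = add B (g x) (g y)"
    and mul: "\<And>x y. \<lbrakk>x \<in> carr A; y \<in> carr A\<rbrakk> \<Longrightarrow> g (mul A x y) = mul B (g x) (g y)"
  shows "identities B \<subseteq> identities A"
proof
  fix e assume e: "e \<in> identities B"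
  have "evaluate A v (fst e) = evaluate A v (snd e)" if v: "range v \<subseteq> carr A" for v
  proof -
    have ev: "g (evaluate A v t) = evaluate B (g \<circ> v) t" for t
      by (induction t) (simp_all add: add mul evaluate_closed[OF A v])
    have "range (g \<circ> v) \<subseteq> carr B"
      using v g(2) by auto
    then have "g (evaluate A v (fst e)) = g (evaluate A v (snd e))"
      using e by (simp add: ev identities_def satisfies_def)
    then show ?thesis
      using g(1) evaluate_closed[OF A v] by (auto dest: inj_onD)
  qed
  then show "e \<in> identities A"
    by (simp add: identities_def satisfies_def)
qed

section \<open>Isomorphic copies on another type\<close>

definition transport :: "('a \<Rightarrow> 'b) \<Rightarrow> 'a semiring_alg \<Rightarrow> 'b semiring_alg" where
  "transport h A = (let k = inv_into (carr A) h in
     \<lparr>carr = h ` carr A, add = (\<lambda>x y. h (add A (k x) (k y))), mul = (\<lambda>x y. h (mul A (k x) (k y)))\<rparr>)"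

lemma transport_simps:
  assumes "inj_on h (carr A)"
  shows "carr (transport h A) = h ` carr A"
    and "\<lbrakk>x \<in> carr A; y \<in> carr A\<rbrakk> \<Longrightarrow> add (transport h A) (h x) (h y) = h (add A x y)"
    and "\<lbrakk>x \<in> carr A; y \<in> carr A\<rbrakk> \<Longrightarrow> mul (transport h A) (h x) (h y) = h (mul A x y)"
  using assms by (simp_all add: transport_def Let_def)

lemma ai_semiring_transport:
  assumes "ai_semiring A" and h: "inj_on h (carr A)"
  shows "ai_semiring (transport h A)"
proof -
  interpret ai_semiring A by fact
  note simps = transport_simps[OF h] add_closed mul_closed
  show ?thesis
  proof
    show "carr (transport h A) \<noteq> {}"
      using carr_nonempty by (simp add: simps)
    fix x y assume "x \<in> carr (transport h A)" "y \<in> carr (transport h A)"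
    then show "add (transport h A) x y = add (transport h A) y x"
      by (auto simp: simps) (simp add: add_comm)
  qed (auto simp: simps add_assoc mul_assoc add_idem distrib_left distrib_right)
qed

lemma identities_transport:
  assumes A: "ai_semiring A" and h: "inj_on h (carr A)"
  shows "identities (transport h A) = identities A"
proof
  note simps = transport_simps[OF h] ai_semiring.add_closed[OF A] ai_semiring.mul_closed[OF A]
  show "identities (transport h A) \<subseteq> identities A"
    using h by (intro identities_antimono_embedding[OF A h]) (simp_all add: simps)
  show "identities A \<subseteq> identities (transport h A)"
    using h by (intro identities_antimono_embedding[OF ai_semiring_transport[OF A h],
          where g = "inv_into (carr A) h"])
      (auto simp: simps inj_on_inv_into)
qed

text \<open>Varieties here consist of algebras on \<open>'u\<close>, whereas the separating algebras
  live on another type; an infinite \<open>'u\<close> has room for every finite one.\<close>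

lemma exists_copy:
  fixes A :: "'a semiring_alg"
  assumes A: "ai_semiring A" and "finite (carr A)"
  shows "\<exists>B :: 'u::infinite semiring_alg. ai_semiring B \<and> identities B = identities A"
proof -
  obtain C :: "'u set" where C: "finite C" "card C = card (carr A)"
    using infinite_arbitrarily_large[OF infinite_UNIV] by blast
  then obtain h where "bij_betw h (carr A) C"
    using assms(2) finite_same_card_bij by metis
  then have "inj_on h (carr A)"
    by (rule bij_betw_imp_inj_on)
  then show ?thesis
    using ai_semiring_transport[OF A] identities_transport[OF A] by blast
qed

section \<open>At most continuum many varieties\<close>

instance trm :: countable
  by countable_datatype

lemma models_eq: "models E = {A. ai_semiring A \<and> E \<subseteq> identities A}"
  by (auto simp: models_def identities_def)

text \<open>A variety is recovered as the class of models of the identities common to its members,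
  and there are only countably many identities to choose from.\<close>

lemma varieties_lepoll: "{K :: 'u semiring_alg set. variety K} \<lesssim> (UNIV :: nat set set)"
proof -
  define F :: "'u semiring_alg set \<Rightarrow> nat set" where
    "F K = to_nat ` (\<Inter>A\<in>K. identities A)" for K
  have "inj_on F {K. variety K}"
  proof (rule inj_onI, clarsimp)
    fix K K' :: "'u semiring_alg set"
    assume K: "variety K" "variety K'" and "F K = F K'"
    then have "(\<Inter>A\<in>K. identities A) = (\<Inter>A\<in>K'. identities A)"
      by (simp add: F_def inj_image_eq_iff)
    moreover have "models (\<Inter>A\<in>K. identities A) = K" if "variety K" for K :: "'u semiring_alg set"
    proof -
      obtain E where E: "K = models E"
        using \<open>variety K\<close> by (auto simp: variety_def)
      then have "E \<subseteq> (\<Inter>A\<in>K. identities A)"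
        by (auto simp: models_eq)
      with E show ?thesis
        unfolding models_eq by blast
    qed
    ultimately show "K = K'"
      using K by metis
  qed
  then show ?thesis
    unfolding lepoll_def by blast
qed

section \<open>Flat algebras of sets of letters\<close>

fun set_mul :: "('a \<Rightarrow> 'a \<Rightarrow> bool) \<Rightarrow> 'a set option \<Rightarrow> 'a set option \<Rightarrow> 'a set option" where
  "set_mul ok (Some P) (Some Q) = (if \<forall>p\<in>P. \<forall>q\<in>Q. ok p q then Some (P \<union> Q) else None)"
| "set_mul ok _ _ = None"

definition set_alg :: "'a set \<Rightarrow> ('a \<Rightarrow> 'a \<Rightarrow> bool) \<Rightarrow> 'a set option semiring_alg" where
  "set_alg L ok = \<lparr>carr = insert None (Some ` (Pow L - {{}})),
     add = (\<lambda>x y. if x = y then x else None), mul = set_mul ok\<rparr>"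

lemma set_mul_None [simp]: "set_mul ok x None = None"
  by (cases x) auto

lemma set_mul_eq_Some_iff:
  "set_mul ok x y = Some R \<longleftrightarrow>
     (\<exists>P Q. x = Some P \<and> y = Some Q \<and> (\<forall>p\<in>P. \<forall>q\<in>Q. ok p q) \<and> R = P \<union> Q)"
  by (cases x; cases y) auto

lemma set_mul_assoc: "set_mul ok (set_mul ok x y) z = set_mul ok x (set_mul ok y z)"
  by (cases x; cases y; cases z) (auto simp: ball_Un Un_assoc)

text \<open>Irreflexivity makes the factors of a nonzero product disjoint, so each factor is the
  complement of the other in the product. Distributivity over a flat addition rests on this
  cancellation.\<close>

lemma set_mul_cancel_left:
  assumes "irreflp ok" "set_mul ok x y = set_mul ok x z" "set_mul ok x y \<noteq> None"
  shows "y = z"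
proof -
  obtain R where "set_mul ok x y = Some R" "set_mul ok x z = Some R"
    using assms(2,3) by auto
  then obtain P Q Q' where *: "x = Some P" "y = Some Q" "z = Some Q'" "P \<union> Q = P \<union> Q'"
      "\<forall>p\<in>P. \<forall>q\<in>Q. ok p q" "\<forall>p\<in>P. \<forall>q\<in>Q'. ok p q"
    by (auto simp: set_mul_eq_Some_iff)
  then have "P \<inter> Q = {}" "P \<inter> Q' = {}"
    using assms(1) by (meson disjoint_iff irreflpD)+
  with * show ?thesis
    by blast
qed

lemma set_mul_cancel_right:
  assumes "irreflp ok" "set_mul ok x z = set_mul ok y z" "set_mul ok x z \<noteq> None"
  shows "x = y"
proof -
  obtain R where "set_mul ok x z = Some R" "set_mul ok y z = Some R"
    using assms(2,3) by auto
  then obtain P Q Q' where *: "z = Some P" "x = Some Q" "y = Some Q'" "Q \<union> P = Q' \<union> P"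
      "\<forall>q\<in>Q. \<forall>p\<in>P. ok q p" "\<forall>q\<in>Q'. \<forall>p\<in>P. ok q p"
    by (auto simp: set_mul_eq_Some_iff)
  then have "P \<inter> Q = {}" "P \<inter> Q' = {}"
    using assms(1) by (meson disjoint_iff irreflpD)+
  with * show ?thesis
    by blast
qed

lemma ai_semiring_set_alg:
  assumes "irreflp ok"
  shows "ai_semiring (set_alg L ok)"
proof
  fix x y z
  show "carr (set_alg L ok) \<noteq> {}"
    by (simp add: set_alg_def)
  show "add (set_alg L ok) (add (set_alg L ok) x y) z
      = add (set_alg L ok) x (add (set_alg L ok) y z)"
    by (simp add: set_alg_def)
  show "add (set_alg L ok) x y = add (set_alg L ok) y x"
    by (simp add: set_alg_def)
  show "add (set_alg L ok) x x = x"
    by (simp add: set_alg_def)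
  show "mul (set_alg L ok) (mul (set_alg L ok) x y) z
      = mul (set_alg L ok) x (mul (set_alg L ok) y z)"
    by (simp add: set_alg_def set_mul_assoc)
  show "mul (set_alg L ok) x (add (set_alg L ok) y z)
      = add (set_alg L ok) (mul (set_alg L ok) x y) (mul (set_alg L ok) x z)"
  proof -
    \<comment> \<open>For distinct \<open>y\<close> and \<open>z\<close> the left side is zero, so
      equal products on the right must be zero as well.\<close>
    have "None = set_mul ok x z" if "y \<noteq> z" "set_mul ok x y = set_mul ok x z"
      using set_mul_cancel_left[OF assms that(2)] that by metis
    then show ?thesis
      by (simp add: set_alg_def)
  qed
  show "mul (set_alg L ok) (add (set_alg L ok) x y) z
      = add (set_alg L ok) (mul (set_alg L ok) x z) (mul (set_alg L ok) y z)"
  proof -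
    have "None = set_mul ok y z" if "x \<noteq> y" "set_mul ok x z = set_mul ok y z"
      using set_mul_cancel_right[OF assms that(2)] that by metis
    then show ?thesis
      by (simp add: set_alg_def)
  qed
  assume xy: "x \<in> carr (set_alg L ok)" "y \<in> carr (set_alg L ok)"
  then show "add (set_alg L ok) x y \<in> carr (set_alg L ok)"
    by (simp add: set_alg_def)
  show "mul (set_alg L ok) x y \<in> carr (set_alg L ok)"
    using xy by (cases "mul (set_alg L ok) x y") (auto simp: set_alg_def set_mul_eq_Some_iff intro!: imageI)
qed

section \<open>Coordinates in \<open>B21\<close>\<close>

text \<open>
  The coordinate of \<open>P\<close> at a letter \<open>x\<close> is \<open>a\<close> if \<open>P\<close> contains \<open>x\<close> (\<open>c\<close>). Otherwise its product with
  \<open>a\<close> on the left is \<open>a\<close> iff \<open>P\<close> may stand to the right of \<open>x\<close> (\<open>r\<close>), and symmetrically (\<open>l\<close>).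
\<close>

definition side_val :: "bool \<Rightarrow> bool \<Rightarrow> bool \<Rightarrow> int^2^2" where
  "side_val c r l = (if c then mA else if r then if l then mat 1 else mBA else if l then mAB else 0)"

definition coord :: "('a \<Rightarrow> 'a \<Rightarrow> bool) \<Rightarrow> 'a \<Rightarrow> 'a set \<Rightarrow> int^2^2" where
  "coord ok x P = side_val (x \<in> P) (\<forall>p\<in>P. ok x p) (\<forall>p\<in>P. ok p x)"

lemma B21_mult_zero: "(0::int^2^2) ** x = 0" "x ** (0::int^2^2) = 0"
  by (simp_all add: vec_eq_iff matrix_matrix_mult_def)

lemmas B21_tables = B21_plus_table B21_mult B21_mult_zero B21_distinct[simplified]

text \<open>The hypotheses say that the letter lies in at most one factor and that the other factor
  may stand on the required side of it. If it lies in neither, the values \<open>1\<close>,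
  \<open>ab\<close>, \<open>ba\<close>, \<open>0\<close> multiply by intersecting the permitted
  sides.\<close>

lemma side_val_mult:
  assumes "\<not> (c \<and> c')" "c \<longrightarrow> r'" "c' \<longrightarrow> l"
  shows "side_val c r l ** side_val c' r' l' = side_val (c \<or> c') (r \<and> r') (l \<and> l')"
  using assms by (cases c; cases c'; cases r; cases r'; cases l; cases l')
    (simp_all add: side_val_def B21_tables)

lemma side_val_mult_nonzero:
  assumes "side_val True r l ** side_val c' r' l' \<noteq> 0"
  shows "r'"
  using assms by (cases c'; cases r'; cases l') (simp_all add: side_val_def B21_tables)

text \<open>The only upper bounds of \<open>mA\<close> are itself and \<open>0\<close>, so adding
  any other value gives \<open>0\<close>.\<close>

lemma side_val_plus_nonzero:
  assumes "B21_plus (side_val c r l) (side_val c' r' l') \<noteq> 0"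
  shows "c \<longleftrightarrow> c'"
  using assms by (cases c; cases c'; cases r; cases r'; cases l; cases l')
    (simp_all add: side_val_def B21_tables)

lemma zero_in_carr_B21: "0 \<in> carr B21"
  by (simp add: B21_def B21_carrier_def)

lemma coord_in_carr: "coord ok x P \<in> carr B21"
  by (simp add: coord_def side_val_def B21_def B21_carrier_def)

lemma coord_eq_mA_iff: "coord ok x P = mA \<longleftrightarrow> x \<in> P"
  using B21_distinct by (auto simp: coord_def side_val_def)

lemma coord_Un:
  assumes "irreflp ok" "\<forall>p\<in>P. \<forall>q\<in>Q. ok p q"
  shows "coord ok x (P \<union> Q) = coord ok x P ** coord ok x Q"
proof -
  have "\<not> (x \<in> P \<and> x \<in> Q)"
    using assms irreflpD by metis
  then have "coord ok x P ** coord ok x Q =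
      side_val (x \<in> P \<or> x \<in> Q) ((\<forall>p\<in>P. ok x p) \<and> (\<forall>p\<in>Q. ok x p))
        ((\<forall>p\<in>P. ok p x) \<and> (\<forall>p\<in>Q. ok p x))"
    unfolding coord_def using assms(2) by (intro side_val_mult) blast+
  then show ?thesis
    by (simp only: coord_def ball_Un Un_iff)
qed

lemma coord_mult_nonzero:
  assumes "x \<in> P" "coord ok x P ** coord ok x Q \<noteq> 0"
  shows "\<forall>q\<in>Q. ok x q"
  using assms(2) unfolding coord_def eqTrueI[OF assms(1)] by (rule side_val_mult_nonzero)

lemma coord_plus_nonzero:
  assumes "B21_plus (coord ok x P) (coord ok x Q) \<noteq> 0"
  shows "x \<in> P \<longleftrightarrow> x \<in> Q"
  using assms unfolding coord_def by (rule side_val_plus_nonzero)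

text \<open>A variable whose value is not contained in \<open>Q\<close> cannot occur in a term of
  value \<open>Q\<close>; sending it to \<open>0\<close> bars it from every term of nonzero
  value.\<close>

definition coord_assign ::
    "('a \<Rightarrow> 'a \<Rightarrow> bool) \<Rightarrow> 'a set \<Rightarrow> (nat \<Rightarrow> 'a set option) \<Rightarrow> 'a \<Rightarrow> nat \<Rightarrow> int^2^2" where
  "coord_assign ok Q v x i =
     (case v i of None \<Rightarrow> 0 | Some P \<Rightarrow> if P \<subseteq> Q then coord ok x P else 0)"

lemma evaluate_coord_assign:
  assumes "irreflp ok" "evaluate (set_alg L ok) v t = Some P" "P \<subseteq> Q"
  shows "evaluate B21 (coord_assign ok Q v x) t = coord ok x P"
  using assms(2,3)
proof (induction t arbitrary: P)
  case (Var i)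
  then show ?case by (simp add: coord_assign_def)
next
  case (Plus s t)
  then have "evaluate (set_alg L ok) v s = Some P" "evaluate (set_alg L ok) v t = Some P"
    by (auto simp: set_alg_def split: if_splits)
  with Plus.IH Plus.prems(2) have "evaluate B21 (coord_assign ok Q v x) s = coord ok x P"
      "evaluate B21 (coord_assign ok Q v x) t = coord ok x P"
    by blast+
  then show ?case
    by (simp add: B21_def B21_plus_def)
next
  case (Times s t)
  then obtain R S where "evaluate (set_alg L ok) v s = Some R"
      "evaluate (set_alg L ok) v t = Some S" "\<forall>p\<in>R. \<forall>q\<in>S. ok p q" "P = R \<union> S"
    by (auto simp: set_alg_def set_mul_eq_Some_iff intro!: imageI)
  with Times.IH Times.prems(2) have "evaluate B21 (coord_assign ok Q v x) s = coord ok x R"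
      "evaluate B21 (coord_assign ok Q v x) t = coord ok x S"
    by blast+
  then show ?case
    by (simp add: B21_def coord_Un[OF assms(1) \<open>\<forall>p\<in>R. \<forall>q\<in>S. ok p q\<close>] \<open>P = R \<union> S\<close>)
qed

text \<open>Nonzero coordinates at all letters of \<open>Q\<close> force the summands of a sum to
  agree and every pair of letters across a product to be permitted.\<close>

lemma evaluate_coord_assign_nonzero:
  assumes "irreflp ok" "Q \<noteq> {}"
    and "\<And>x. x \<in> Q \<Longrightarrow> evaluate B21 (coord_assign ok Q v x) t \<noteq> 0"
  shows "\<exists>P\<subseteq>Q. evaluate (set_alg L ok) v t = Some P"
  using assms(3)
proof (induction t)
  case (Var i)
  obtain x where "x \<in> Q"
    using \<open>Q \<noteq> {}\<close> by blast
  from Var[OF this] show ?case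
    by (cases "v i") (simp_all add: coord_assign_def split: if_splits)
next
  case (Plus s t)
  let ?e = "\<lambda>x. evaluate B21 (coord_assign ok Q v x)"
  have nz: "B21_plus (?e x s) (?e x t) \<noteq> 0" if "x \<in> Q" for x
    using Plus.prems[OF that] by (simp add: B21_def)
  have "?e x s \<noteq> 0" "?e x t \<noteq> 0" if "x \<in> Q" for x
    using nz[OF that] B21_plus_table(6,7) by fastforce+
  then obtain P P' where P: "P \<subseteq> Q" "evaluate (set_alg L ok) v s = Some P"
      and P': "P' \<subseteq> Q" "evaluate (set_alg L ok) v t = Some P'"
    using Plus.IH by blast
  have "x \<in> P \<longleftrightarrow> x \<in> P'" if "x \<in> Q" for x
    using nz[OF that] coord_plus_nonzero[of ok x P P']
    by (simp add: evaluate_coord_assign[OF assms(1) P(2,1)]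
        evaluate_coord_assign[OF assms(1) P'(2,1)])
  with P P' have "P = P'"
    by blast
  with P P' show ?case
    by (simp add: set_alg_def)
next
  case (Times s t)
  let ?e = "\<lambda>x. evaluate B21 (coord_assign ok Q v x)"
  have nz: "?e x s ** ?e x t \<noteq> 0" if "x \<in> Q" for x
    using Times.prems[OF that] by (simp add: B21_def)
  have "?e x s \<noteq> 0" "?e x t \<noteq> 0" if "x \<in> Q" for x
    using nz[OF that] B21_mult_zero by fastforce+
  then obtain P P' where P: "P \<subseteq> Q" "evaluate (set_alg L ok) v s = Some P"
      and P': "P' \<subseteq> Q" "evaluate (set_alg L ok) v t = Some P'"
    using Times.IH by blast
  have "\<forall>q\<in>P'. ok x q" if "x \<in> P" for x
    using nz[of x] coord_mult_nonzero[OF that, of ok P'] that P(1)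
    by (auto simp: evaluate_coord_assign[OF assms(1) P(2,1)]
        evaluate_coord_assign[OF assms(1) P'(2,1)])
  with P P' show ?case
    by (simp add: set_alg_def)
qed

lemma identities_B21_subset_set_alg:
  assumes "irreflp ok"
  shows "identities B21 \<subseteq> identities (set_alg L ok)"
proof
  fix e assume e: "e \<in> identities B21"
  \<comment> \<open>One direction suffices: applied to both sides of the identity, it also settles
    the value \<open>None\<close>.\<close>
  have transfer: "evaluate (set_alg L ok) v t = Some Q"
    if "range v \<subseteq> carr (set_alg L ok)" "evaluate (set_alg L ok) v s = Some Q"
      and eq: "\<And>w. range w \<subseteq> carr B21 \<Longrightarrow> evaluate B21 w s = evaluate B21 w t" for v Q s t
  proof -
    have "Q \<noteq> {}"
      using evaluate_closed[OF ai_semiring_set_alg[OF assms] that(1), of s] that(2)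
      by (auto simp: set_alg_def)
    have "coord_assign ok Q v x i \<in> carr B21" for x i
      by (cases "v i") (simp_all add: coord_assign_def coord_in_carr zero_in_carr_B21)
    then have ev: "evaluate B21 (coord_assign ok Q v x) t = coord ok x Q" for x
      using evaluate_coord_assign[OF assms that(2) order.refl, of x] eq[of "coord_assign ok Q v x"]
      by (simp add: image_subset_iff)
    have "evaluate B21 (coord_assign ok Q v x) t \<noteq> 0" if "x \<in> Q" for x
      using coord_eq_mA_iff[of ok x Q] that B21_distinct by (simp add: ev)
    then obtain P where P: "P \<subseteq> Q" "evaluate (set_alg L ok) v t = Some P"
      using evaluate_coord_assign_nonzero[OF assms \<open>Q \<noteq> {}\<close>] by blast
    have "coord ok x P = coord ok x Q" for x
      using evaluate_coord_assign[OF assms P(2,1), of x] ev[of x] by simp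
    then have "x \<in> P \<longleftrightarrow> x \<in> Q" for x
      using coord_eq_mA_iff[of ok x P] coord_eq_mA_iff[of ok x Q] by simp
    then have "P = Q"
      by blast
    with P show ?thesis
      by simp
  qed
  have "evaluate (set_alg L ok) v (fst e) = evaluate (set_alg L ok) v (snd e)"
    if "range v \<subseteq> carr (set_alg L ok)" for v
  proof -
    have eq: "evaluate B21 w (fst e) = evaluate B21 w (snd e)" if "range w \<subseteq> carr B21" for w
      using e that by (simp add: identities_def satisfies_def)
    show ?thesis
    proof (cases "evaluate (set_alg L ok) v (fst e)")
      case (Some Q)
      then show ?thesis
        using transfer[OF that Some eq] by simp
    next
      case None
      then have "evaluate (set_alg L ok) v (snd e) \<noteq> Some Q" for Q
        using transfer[OF that _ eq[symmetric], of Q] by auto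
      with None show ?thesis
        by (cases "evaluate (set_alg L ok) v (snd e)") auto
    qed
  qed
  then show "e \<in> identities (set_alg L ok)"
    by (simp add: identities_def satisfies_def)
qed

section \<open>Words and their sums\<close>

text \<open>The signature has no constants, so the empty product, like the empty sum below, has only
  a dummy value; no list in use is empty.\<close>

fun word :: "nat list \<Rightarrow> trm" where
  "word [] = undefined"
| "word [i] = Var i"
| "word (i # is) = Times (Var i) (word is)"

fun sum_trm :: "trm list \<Rightarrow> trm" where
  "sum_trm [] = undefined"
| "sum_trm [t] = t"
| "sum_trm (t # ts) = Plus t (sum_trm ts)"

definition compatible :: "('a \<Rightarrow> 'a \<Rightarrow> bool) \<Rightarrow> 'a set \<Rightarrow> 'a set \<Rightarrow> bool" where
  "compatible ok P Q \<longleftrightarrow> (\<forall>p\<in>P. \<forall>q\<in>Q. ok p q)"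

text \<open>Compatibility with a union is compatibility with each of its parts, so a product is
  nonzero under pairwise conditions.\<close>

lemma evaluate_word_set_alg:
  assumes "is \<noteq> []"
  shows "evaluate (set_alg L ok) v (word is) = Some Q \<longleftrightarrow>
    None \<notin> v ` set is \<and> sorted_wrt (\<lambda>i j. compatible ok (the (v i)) (the (v j))) is \<and>
    Q = (\<Union>i\<in>set is. the (v i))"
  using assms
proof (induction "is" arbitrary: Q rule: word.induct)
  case (2 i)
  then show ?case by (cases "v i") auto
next
  case (3 i j "is")
  have "evaluate (set_alg L ok) v (word (i # j # is)) = Some Q \<longleftrightarrow>
    (\<exists>P R. v i = Some P \<and> evaluate (set_alg L ok) v (word (j # is)) = Some R \<and>
      compatible ok P R \<and> Q = P \<union> R)"
    by (simp add: set_alg_def set_mul_eq_Some_iff compatible_def)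
  also have "\<dots> \<longleftrightarrow> None \<notin> v ` set (i # j # is) \<and>
      sorted_wrt (\<lambda>i j. compatible ok (the (v i)) (the (v j))) (i # j # is) \<and>
      Q = (\<Union>i\<in>set (i # j # is). the (v i))"
    unfolding 3(1)[OF list.distinct(2)] by (cases "v i") (auto simp: compatible_def ball_Un)
  finally show ?case .
qed simp

lemma evaluate_sum_trm_set_alg:
  assumes "ts \<noteq> []"
  shows "evaluate (set_alg L ok) v (sum_trm ts) = Some Q \<longleftrightarrow>
    (\<forall>t\<in>set ts. evaluate (set_alg L ok) v t = Some Q)"
  using assms
  by (induction ts rule: sum_trm.induct) (auto simp: set_alg_def)

lemma evaluate_word_rev_S7:
  assumes "is \<noteq> []"
  shows "evaluate S7 v (word (rev is)) = evaluate S7 v (word is)"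
proof -
  \<comment> \<open>The unit \<open>S1\<close> lets the fold start from an empty product.\<close>
  have word: "evaluate S7 v (word is) = foldr (\<lambda>i. mul S7 (v i)) is S1" if "is \<noteq> []" for "is"
    using that by (induction "is" rule: word.induct) (simp_all, simp add: S7_def)
  have "mul S7 x (mul S7 y z) = mul S7 y (mul S7 x z)" for x y z
    by (cases x; cases y; cases z) (simp_all add: S7_def)
  then have "foldr (\<lambda>i. mul S7 (v i)) is = fold (\<lambda>i. mul S7 (v i)) is"
    by (intro foldr_fold) (auto simp: fun_eq_iff)
  with assms show ?thesis
    by (simp add: word foldr_conv_fold)
qed

section \<open>Double forks\<close>

text \<open>
  The double fork of index \<open>n\<close> has the vertices \<open>0, \<dots>, n + 5\<close>: a path from \<open>2\<close> to \<open>n + 3\<close>, leaves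
  \<open>0\<close> and \<open>1\<close> at \<open>2\<close>, leaves \<open>n + 4\<close> and \<open>n + 5\<close> at \<open>n + 3\<close>. Edges are directed upwards.
\<close>

definition fork_edge :: "nat \<Rightarrow> nat \<Rightarrow> nat \<Rightarrow> bool" where
  "fork_edge n i j \<longleftrightarrow> j = 2 \<and> i < 2 \<or> 2 \<le> i \<and> j = Suc i \<and> j \<le> n + 3 \<or>
     i = n + 3 \<and> (j = n + 4 \<or> j = n + 5)"

definition fork_adj :: "nat \<Rightarrow> nat \<Rightarrow> nat \<Rightarrow> bool" where
  "fork_adj n i j \<longleftrightarrow> fork_edge n i j \<or> fork_edge n j i"

lemma fork_adj_branching:
  assumes "fork_adj n c x" "fork_adj n c y" "fork_adj n c z" "x \<noteq> y" "x \<noteq> z" "y \<noteq> z"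
  shows "c = 2 \<or> c = n + 3"
proof (rule ccontr)
  assume c: "\<not> (c = 2 \<or> c = n + 3)"
  \<comment> \<open>Away from the branching vertices there are at most two candidates for a
    neighbour, too few for three distinct ones.\<close>
  have "w = Suc c \<or> w = (if c < 2 then 2 else if c < n + 3 then c - 1 else n + 3)"
    if "fork_adj n c w" for w
    using that c by (auto simp: fork_adj_def fork_edge_def)
  then have "x = Suc c \<or> y = Suc c" "x = Suc c \<or> z = Suc c" "y = Suc c \<or> z = Suc c"
    using assms by metis+
  with assms(4-6) show False
    by auto
qed

text \<open>
  The branching vertices \<open>2\<close> and \<open>m + 3\<close> are the only ones of degree at least three, so an
  embedding preserves them, and the path between them cannot get shorter.
\<close>

lemma fork_embedding:
  assumes inj: "inj_on f {..<m + 6}" and sub: "f ` {..<m + 6} \<subseteq> {..<n + 6}"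
    and adj: "\<And>i j. fork_edge m i j \<Longrightarrow> fork_adj n (f i) (f j)"
  shows "m = n"
proof -
  \<comment> \<open>Counting vertices gives one inequality, distances will give the other.\<close>
  have "m \<le> n"
    using card_inj_on_le[OF inj sub] by simp
  have neq: "f i \<noteq> f j" if "i < m + 6" "j < m + 6" "i \<noteq> j" for i j
    using inj that by (auto dest: inj_onD)
  have sym: "fork_adj n x y \<longleftrightarrow> fork_adj n y x" for x y
    by (auto simp: fork_adj_def)
  have "fork_adj n (f 2) (f 0)" "fork_adj n (f 2) (f 1)" "fork_adj n (f 2) (f 3)"
    using adj[of 0 2] adj[of 1 2] adj[of 2 3] adj[of 2 4]
    by (auto simp: fork_edge_def sym[of "f 2"])
  then have f2: "f 2 = 2 \<or> f 2 = n + 3"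
    by (rule fork_adj_branching) (simp_all add: neq)
  have "fork_adj n (f (m + 3)) (f (m + 4))" "fork_adj n (f (m + 3)) (f (m + 5))"
      "fork_adj n (f (m + 3)) (f (m + 2))"
    using adj[of "m + 3" "m + 4"] adj[of "m + 3" "m + 5"] adj[of "m + 2" "m + 3"]
    by (auto simp: fork_edge_def sym[of "f (m + 3)"])
  then have fm: "f (m + 3) = 2 \<or> f (m + 3) = n + 3"
    by (rule fork_adj_branching) (simp_all add: neq)
  \<comment> \<open>\<open>h\<close> folds the leaves onto their branching vertices: neighbours then
    differ by at most one, the two branching vertices by \<open>n + 1\<close>.\<close>
  define h where "h x = min (max (int x) 2) (int n + 3)" for x
  have step: "\<bar>h y - h x\<bar> \<le> 1" if "fork_adj n x y" for x y
    using that unfolding h_def fork_adj_def fork_edge_def by auto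
  have "\<bar>h (f (k + 2)) - h (f 2)\<bar> \<le> int k" if "k \<le> m + 1" for k
    using that
  proof (induction k)
    case (Suc k)
    then have "fork_edge m (k + 2) (Suc k + 2)"
      by (simp add: fork_edge_def)
    from step[OF adj[OF this]] Suc show ?case
      by simp
  qed (simp add: numeral_2_eq_2)
  from this[of "m + 1"] have "\<bar>h (f (m + 3)) - h (f 2)\<bar> \<le> int m + 1"
    by (simp add: numeral_3_eq_3)
  moreover have "f (m + 3) \<noteq> f 2"
    by (rule neq) auto
  ultimately have "n \<le> m"
    using f2 fm by (auto simp: h_def)
  with \<open>m \<le> n\<close> show ?thesis
    by simp
qed

section \<open>Fork algebras and their identities\<close>

definition fork_ok :: "nat \<Rightarrow> nat \<Rightarrow> nat \<Rightarrow> bool" where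
  "fork_ok n i j \<longleftrightarrow> i < j \<or> fork_edge n j i"

lemma irreflp_fork_ok: "irreflp (fork_ok n)"
  by (auto simp: irreflp_def fork_ok_def fork_edge_def)

definition fork_alg :: "nat \<Rightarrow> nat set option semiring_alg" where
  "fork_alg n = set_alg {..<n + 6} (fork_ok n)"

text \<open>Each word is the increasing one, up to reversing one or two edges.\<close>

definition fork_words :: "nat \<Rightarrow> nat list list" where
  "fork_words n = [[0..<n + 6], [2, 0, 1] @ [3..<n + 6], [0..<n + 3] @ [n + 4, n + 5, n + 3]]
     @ map (\<lambda>i. [0..<i] @ [Suc i, i] @ [Suc (Suc i)..<n + 6]) [2..<n + 3]"

text \<open>\<open>R\<close> already contains the increasing word, so the left side amounts to
  \<open>R\<close> and the right side to \<open>R\<close> plus the reversed word. With the extra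
  copy the two sides differ by a reversal only, which \<open>S7\<close> ignores.\<close>

definition fork_identity :: "nat \<Rightarrow> trm \<times> trm" where
  "fork_identity n = (let R = sum_trm (map word (fork_words n)) in
     (Plus (word [0..<n + 6]) R, Plus (word (rev [0..<n + 6])) R))"

lemma S7_fork_identity: "satisfies S7 (fork_identity n)"
  by (simp add: satisfies_def fork_identity_def Let_def evaluate_word_rev_S7)

lemma fork_words_simps: "w \<in> set (fork_words n) \<Longrightarrow> w \<noteq> [] \<and> set w = {..<n + 6}"
  by (auto simp: fork_words_def)

text \<open>All inversions of these words are edges, the only decreasing pairs allowed.\<close>

lemma sorted_wrt_fork_words:
  assumes "w \<in> set (fork_words n)"
  shows "sorted_wrt (fork_ok n) w"
proof -
  have "sorted_wrt (fork_ok n) [i..<j]" for i j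
    by (rule sorted_wrt_mono_rel[OF _ sorted_wrt_upt]) (simp add: fork_ok_def)
  with assms show ?thesis
    by (auto simp: fork_words_def sorted_wrt_append fork_ok_def fork_edge_def simp del: upt_Suc)
qed

lemma fork_edge_reversed:
  assumes "fork_edge n i j"
  shows "\<exists>w\<in>set (fork_words n). \<forall>ok. sorted_wrt ok w \<longrightarrow> ok j i"
proof -
  consider "j = 2" "i = 0 \<or> i = 1" | "2 \<le> i" "i < n + 3" "j = Suc i"
    | "i = n + 3" "j = n + 4 \<or> j = n + 5"
    using assms by (fastforce simp: fork_edge_def)
  then show ?thesis
  proof cases
    case 1
    then show ?thesis
      by (intro bexI[of _ "[2, 0, 1] @ [3..<n + 6]"]) (auto simp: fork_words_def simp del: upt_Suc)
  next
    case 2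
    then show ?thesis
      by (intro bexI[of _ "[0..<i] @ [Suc i, i] @ [Suc (Suc i)..<n + 6]"])
        (auto simp: fork_words_def sorted_wrt_append simp del: upt_Suc)
  next
    case 3
    then show ?thesis
      by (intro bexI[of _ "[0..<n + 3] @ [n + 4, n + 5, n + 3]"])
        (auto simp: fork_words_def sorted_wrt_append simp del: upt_Suc)
  qed
qed

text \<open>A flat sum is nonzero only if its summands coincide, and the increasing word is among
  those of the sum, so only the reversed word remains to be tested.\<close>

lemma fork_identity_satisfied_iff:
  "satisfies (fork_alg n) (fork_identity m) \<longleftrightarrow>
     (\<forall>v Q. range v \<subseteq> carr (fork_alg n) \<longrightarrow>
       (\<forall>w\<in>set (fork_words m). evaluate (fork_alg n) v (word w) = Some Q) \<longrightarrow>
       evaluate (fork_alg n) v (word (rev [0..<m + 6])) = Some Q)"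
proof -
  have eq: "x = y \<longleftrightarrow> (\<forall>Q. x = Some Q \<longleftrightarrow> y = Some Q)" for x y :: "nat set option"
    by (metis not_None_eq)
  have plus: "evaluate (fork_alg n) v (Plus s t) = Some Q \<longleftrightarrow>
      evaluate (fork_alg n) v s = Some Q \<and> evaluate (fork_alg n) v t = Some Q" for v s t Q
    by (auto simp: fork_alg_def set_alg_def)
  have ne: "map word (fork_words m) \<noteq> []" and mem: "[0..<m + 6] \<in> set (fork_words m)"
    by (simp_all add: fork_words_def)
  have sum: "evaluate (fork_alg n) v (sum_trm (map word (fork_words m))) = Some Q \<longleftrightarrow>
      (\<forall>w\<in>set (fork_words m). evaluate (fork_alg n) v (word w) = Some Q)" for v Q
    unfolding fork_alg_def evaluate_sum_trm_set_alg[OF ne] by simp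
  show ?thesis
    unfolding satisfies_def fork_identity_def Let_def fst_conv snd_conv
    by (subst eq, unfold plus sum) (use mem in blast)
qed

text \<open>Each variable receives its own letter. The words of the sum are permitted, but the
  reversed word puts \<open>1\<close> before \<open>0\<close>, two leaves that are not
  adjacent.\<close>

lemma fork_alg_not_fork_identity: "\<not> satisfies (fork_alg n) (fork_identity n)"
proof
  assume sat: "satisfies (fork_alg n) (fork_identity n)"
  define v :: "nat \<Rightarrow> nat set option" where "v i = (if i < n + 6 then Some {i} else None)" for i
  have "range v \<subseteq> carr (fork_alg n)"
    by (auto simp: v_def fork_alg_def set_alg_def)
  moreover have "evaluate (fork_alg n) v (word w) = Some {..<n + 6}"
    if "w \<in> set (fork_words n)" for w
  proof -
    have w: "w \<noteq> []" "set w = {..<n + 6}"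
      using fork_words_simps[OF that] by auto
    have "sorted_wrt (\<lambda>i j. compatible (fork_ok n) (the (v i)) (the (v j))) w"
      using sorted_wrt_fork_words[OF that]
      by (rule sorted_wrt_mono_rel[rotated]) (auto simp: w v_def compatible_def)
    then show ?thesis
      unfolding fork_alg_def evaluate_word_set_alg[OF w(1)] by (auto simp: w v_def)
  qed
  ultimately have "evaluate (fork_alg n) v (word (rev [0..<n + 6])) = Some {..<n + 6}"
    using sat unfolding fork_identity_satisfied_iff by blast
  then have "sorted_wrt (\<lambda>i j. compatible (fork_ok n) (the (v j)) (the (v i))) [0..<n + 6]"
    by (simp add: fork_alg_def evaluate_word_set_alg sorted_wrt_rev del: upt_Suc)
  then have "compatible (fork_ok n) (the (v 1)) (the (v 0))"
    by (auto simp: sorted_wrt_iff_nth_less simp del: upt_Suc dest!: spec[of _ 0] spec[of _ 1])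
  then show False
    by (simp add: v_def compatible_def fork_ok_def fork_edge_def)
qed

text \<open>The sum is zero under every assignment, since a nonzero value would embed the fork of
  index \<open>m\<close> into that of index \<open>n\<close>.\<close>

lemma fork_alg_fork_identity:
  assumes "m \<noteq> n"
  shows "satisfies (fork_alg n) (fork_identity m)"
proof -
  have False if v: "range v \<subseteq> carr (fork_alg n)"
    and Q: "\<forall>w\<in>set (fork_words m). evaluate (fork_alg n) v (word w) = Some Q" for v Q
  proof -
    have words: "None \<notin> v ` {..<m + 6}"
        "sorted_wrt (\<lambda>i j. compatible (fork_ok n) (the (v i)) (the (v j))) w"
      if "w \<in> set (fork_words m)" for w
      using Q fork_words_simps[OF that] that
      by (auto simp: fork_alg_def evaluate_word_set_alg)
    have base: "[0..<m + 6] \<in> set (fork_words m)"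
      by (simp add: fork_words_def)
    have "\<exists>x. x \<in> the (v i) \<and> x < n + 6" if "i < m + 6" for i
    proof -
      have "v i \<noteq> None" "v i \<in> carr (fork_alg n)"
        using words(1)[OF base] that v by (force, blast)
      then show ?thesis
        by (auto simp: fork_alg_def set_alg_def)
    qed
    then obtain f where f: "\<And>i. i < m + 6 \<Longrightarrow> f i \<in> the (v i) \<and> f i < n + 6"
      by metis
    have up: "fork_ok n (f i) (f j)" if "i < j" "j < m + 6" for i j
    proof -
      have "compatible (fork_ok n) (the (v i)) (the (v j))"
        using words(2)[OF base] that by (auto simp: sorted_wrt_iff_nth_less simp del: upt_Suc)
      then show ?thesis
        using f that by (auto simp: compatible_def)
    qed
    have "f i \<noteq> f j" if "i < j" "j < m + 6" for i j
      using up[OF that] irreflp_fork_ok by (metis irreflpD)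
    then have "inj_on f {..<m + 6}"
      by (metis inj_onI lessThan_iff linorder_neqE_nat)
    moreover have "f ` {..<m + 6} \<subseteq> {..<n + 6}"
      using f by auto
    moreover have "fork_adj n (f i) (f j)" if edge: "fork_edge m i j" for i j
    proof -
      have ij: "i < j" "j < m + 6"
        using edge by (auto simp: fork_edge_def)
      have "compatible (fork_ok n) (the (v j)) (the (v i))"
        using fork_edge_reversed[OF edge] words(2) by metis
      then have "fork_ok n (f j) (f i)"
        using f ij by (auto simp: compatible_def)
      \<comment> \<open>Letters permitted in both orders are adjacent, since \<open><\<close> holds
        in only one of them.\<close>
      with up[OF ij] show ?thesis
        by (auto simp: fork_ok_def fork_adj_def)
    qed
    ultimately have "m = n"
      by (rule fork_embedding)
    with assms show False ..
  qed
  then show ?thesis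
    unfolding fork_identity_satisfied_iff by blast
qed

section \<open>The interval\<close>

lemma identities_B21_subset_S7: "identities B21 \<subseteq> identities S7"
proof (rule identities_antimono_embedding[OF ai_semiring_S7])
  let ?g = "case_s7 0 mA (mat 1 :: int^2^2)"
  show "inj_on ?g (carr S7)"
    using B21_distinct by (auto simp: inj_on_def split: s7.splits)
  show "?g ` carr S7 \<subseteq> carr B21"
    by (auto simp: B21_def B21_carrier_def split: s7.splits)
  show "?g (add S7 x y) = add B21 (?g x) (?g y)" for x y
    by (cases x; cases y) (simp_all add: S7_def B21_def B21_tables)
  show "?g (mul S7 x y) = mul B21 (?g x) (?g y)" for x y
    by (cases x; cases y) (simp_all add: S7_def B21_def B21_tables)
qed

definition fork_variety :: "nat set \<Rightarrow> 'u semiring_alg set" where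
  "fork_variety X = models (identities B21 \<union> fork_identity ` X)"

lemma fork_variety_in_interval:
  "fork_variety X \<in> variety_interval (variety_generated_by S7) (variety_generated_by B21)"
proof -
  have "identities B21 \<union> fork_identity ` X \<subseteq> identities S7"
    using identities_B21_subset_S7 S7_fork_identity by (auto simp: identities_def)
  moreover have "variety (fork_variety X)"
    unfolding variety_def fork_variety_def by blast
  ultimately show ?thesis
    by (auto simp: variety_interval_def variety_generated_by_def fork_variety_def
        models_eq)
qed

text \<open>The algebra of index \<open>n\<close> satisfies every fork identity except its own, so a
  copy of it lies in \<open>fork_variety X\<close> exactly when \<open>X\<close> omits
  \<open>n\<close>.\<close>

lemma fork_variety_subset_imp:
  assumes "(fork_variety X :: 'u::infinite semiring_alg set) \<subseteq> fork_variety Y"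
  shows "Y \<subseteq> X"
proof
  fix n assume "n \<in> Y"
  have "finite (carr (fork_alg n))"
    by (simp add: fork_alg_def set_alg_def)
  then obtain B :: "'u semiring_alg" where B: "ai_semiring B" "identities B = identities (fork_alg n)"
    using exists_copy ai_semiring_set_alg[OF irreflp_fork_ok] unfolding fork_alg_def by metis
  have "B \<notin> fork_variety Y"
    using fork_alg_not_fork_identity[of n] B(2) \<open>n \<in> Y\<close>
    by (auto simp: fork_variety_def models_eq identities_def)
  then have "B \<notin> fork_variety X"
    using assms by blast
  then have "\<not> fork_identity ` X \<subseteq> identities (fork_alg n)"
    using B identities_B21_subset_set_alg[OF irreflp_fork_ok[of n], of "{..<n + 6}"]
    by (auto simp: fork_variety_def models_eq fork_alg_def)
  then show "n \<in> X"
    using fork_alg_fork_identity[of _ n] by (metis identities_def image_subsetI mem_Collect_eq)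
qed

theorem theorem1p1:
  "variety_interval (variety_generated_by S7) (variety_generated_by B21 :: 'u::infinite semiring_alg set)
     \<approx> (UNIV :: nat set set)"
proof (rule lepoll_antisym)
  have "variety_interval (variety_generated_by S7) (variety_generated_by B21) \<subseteq> {K :: 'u semiring_alg set. variety K}"
    by (auto simp: variety_interval_def)
  then show "variety_interval (variety_generated_by S7) (variety_generated_by B21 :: 'u semiring_alg set)
      \<lesssim> (UNIV :: nat set set)"
    using varieties_lepoll by (meson lepoll_trans subset_imp_lepoll)
  \<comment> \<open>Equal varieties include each other, hence so do their index sets.\<close>
  have "inj (fork_variety :: nat set \<Rightarrow> 'u semiring_alg set)"
    by (rule injI) (metis fork_variety_subset_imp order.refl subset_antisym)
  then show "(UNIV :: nat set set)
      \<lesssim> variety_interval (variety_generated_by S7) (variety_generated_by B21 :: 'u semiring_alg set)"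
    using fork_variety_in_interval unfolding lepoll_def by blast
qed

end
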